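(* Let $\mathbb{F}$ be an algebraically closed field with $\mathrm{Char}(\mathbb{F})\neq 2,3$, and let $f$ be the $3$-algebra structure on the $2$-dimensional vector space $V=\mathbb{F}e_1\oplus\mathbb{F}e_2$ with matrix of structure constants $$\left(\begin{array}{cccccccc} 1&0&0&1&0&1&-1&0\\ 0&-1&1&0&1&0&0&1\end{array}\right).$$ Then: (1) $f$ cannot be expressed by any binary multiplication, i.e. there is no bilinear map $\mu:V\times V\to V$ with $f(x,y,z)=\mu(x,\mu(y,z))$ for all $x,y,z\in V$; (2) the $3$-algebra $(V,f)$ is not isomorphic to the $3$-algebra generated by any of the binary algebras $A_1(\alpha_1,\alpha_2,\alpha_4,\beta_1)$, $A_2(\alpha_1,\beta_1,\beta_2)$, $A_3(\beta_1,\beta_2)$, $A_4(\alpha_1,\beta_2)$, $A_5(\alpha_1)$, $A_6(\alpha_1,\beta_1)$, $A_7(\beta_1)$, $A_8(\alpha_1)$, $A_9$, $A_{10}$, $A_{11}$, for any values of the parameters in $\mathbb{F}$.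
   Context: A $3$-algebra is a vector space $V$ with a trilinear map $f:V\times V\times V\to V$. For $V$ with fixed basis $e_1,e_2$, its matrix of structure constants is the $2\times 8$ matrix whose columns, indexed by $(i,j,k)$ in the order $111,112,121,122,211,212,221,222$, are the coordinate vectors of $f(e_i,e_j,e_k)$: if $f(e_i,e_j,e_k)=\gamma^1_{ijk}e_1+\gamma^2_{ijk}e_2$, the column is $(\gamma^1_{ijk},\gamma^2_{ijk})^T$. Two $3$-algebras are isomorphic if there is an invertible linear map $\varphi$ with $\varphi(f(x,y,z))=f'(\varphi(x),\varphi(y),\varphi(z))$ for all $x,y,z$; in terms of the matrices, $B=gA(g^{-1})^{\otimes 3}$ for some $g\in GL(2;\mathbb{F})$. A (binary) algebra on $V$ is a bilinear map $\mu:V\times V\to V$; its matrix of structure constants is the $2\times 4$ matrix whose columns are the coordinate vectors of $\mu(e_1,e_1),\mu(e_1,e_2),\mu(e_2,e_1),\mu(e_2,e_2)$ in this order. The $3$-algebra generated by $(V,\mu)$ is $(V,f_\mu)$ with $f_\mu(x,y,z)=\mu(x,\mu(y,z))$. The binary algebras in question are given by the following matrices of structure constants (rows separated by semicolons, parameters in $\mathbb{F}$): $A_1(\alpha_1,\alpha_2,\alpha_4,\beta_1)=(\alpha_1,\alpha_2,\alpha_2+1,\alpha_4;\ \beta_1,-\alpha_1,-\alpha_1+1,-\alpha_2)$; $A_2(\alpha_1,\beta_1,\beta_2)=(\alpha_1,0,0,1;\ \beta_1,\beta_2,1-\alpha_1,0)$; $A_3(\beta_1,\beta_2)=(0,1,1,0;\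 \beta_1,\beta_2,1,-1)$; $A_4(\alpha_1,\beta_2)=(\alpha_1,0,0,0;\ 0,\beta_2,1-\alpha_1,0)$; $A_5(\alpha_1)=(\alpha_1,0,0,0;\ 1,2\alpha_1-1,1-\alpha_1,0)$; $A_6(\alpha_1,\beta_1)=(\alpha_1,0,0,1;\ \beta_1,1-\alpha_1,-\alpha_1,0)$; $A_7(\beta_1)=(0,1,1,0;\ \beta_1,1,0,-1)$; $A_8(\alpha_1)=(\alpha_1,0,0,0;\ 0,1-\alpha_1,-\alpha_1,0)$; $A_9=(\tfrac13,0,0,0;\ 1,\tfrac23,-\tfrac13,0)$; $A_{10}=(0,1,1,0;\ 0,0,0,-1)$; $A_{11}=(0,1,1,0;\ 1,0,0,-1)$. *)

theory Defs
  imports "HOL-Analysis.Analysis" "HOL-Computational_Algebra.Polynomial"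
begin

text \<open>
  The plane V is realised as \<open>'a ^ 2\<close> with its standard basis.  The constant \<open>linear\<close> of
  \<^theory>\<open>HOL-Analysis.Analysis\<close> is linearity over the reals, so linearity over \<open>'a\<close> is
  \<open>Vector_Spaces.linear (*s) (*s)\<close>.
\<close>

definition e1 :: "'a::field ^ 2" where "e1 = axis 1 1"

definition e2 :: "'a::field ^ 2" where "e2 = axis 2 1"

definition bilinear_map :: "('a::field ^ 2 \<Rightarrow> 'a ^ 2 \<Rightarrow> 'a ^ 2) \<Rightarrow> bool" where
  "bilinear_map \<mu> \<longleftrightarrow>
     (\<forall>y. Vector_Spaces.linear (*s) (*s) (\<lambda>x. \<mu> x y)) \<and>
     (\<forall>x. Vector_Spaces.linear (*s) (*s) (\<lambda>y. \<mu> x y))"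

definition trilinear_map :: "('a::field ^ 2 \<Rightarrow> 'a ^ 2 \<Rightarrow> 'a ^ 2 \<Rightarrow> 'a ^ 2) \<Rightarrow> bool" where
  "trilinear_map f \<longleftrightarrow>
     (\<forall>y z. Vector_Spaces.linear (*s) (*s) (\<lambda>x. f x y z)) \<and>
     (\<forall>x z. Vector_Spaces.linear (*s) (*s) (\<lambda>y. f x y z)) \<and>
     (\<forall>x y. Vector_Spaces.linear (*s) (*s) (\<lambda>z. f x y z))"

text \<open>
  Matrices of type \<open>'a ^ n ^ 2\<close> have 2 rows and \<open>n\<close> columns.  Below, the columns are listed
  as the rows of an \<open>n\<close> by 2 matrix, which is then transposed.
\<close>

definition struct_matrix2 :: "('a::field ^ 2 \<Rightarrow> 'a ^ 2 \<Rightarrow> 'a ^ 2) \<Rightarrow> 'a ^ 4 ^ 2" where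
  "struct_matrix2 \<mu> = transpose (vector [\<mu> e1 e1, \<mu> e1 e2, \<mu> e2 e1, \<mu> e2 e2])"

definition struct_matrix3 :: "('a::field ^ 2 \<Rightarrow> 'a ^ 2 \<Rightarrow> 'a ^ 2 \<Rightarrow> 'a ^ 2) \<Rightarrow> 'a ^ 8 ^ 2" where
  "struct_matrix3 f = transpose (vector
     [f e1 e1 e1, f e1 e1 e2, f e1 e2 e1, f e1 e2 e2,
      f e2 e1 e1, f e2 e1 e2, f e2 e2 e1, f e2 e2 e2])"

definition isomorphic3 ::
  "('a::field ^ 2 \<Rightarrow> 'a ^ 2 \<Rightarrow> 'a ^ 2 \<Rightarrow> 'a ^ 2) \<Rightarrow>
   ('a ^ 2 \<Rightarrow> 'a ^ 2 \<Rightarrow> 'a ^ 2 \<Rightarrow> 'a ^ 2) \<Rightarrow> bool" where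
  "isomorphic3 f f' \<longleftrightarrow>
     (\<exists>\<phi>. Vector_Spaces.linear (*s) (*s) \<phi> \<and> bij \<phi> \<and>
       (\<forall>x y z. \<phi> (f x y z) = f' (\<phi> x) (\<phi> y) (\<phi> z)))"

definition generated3 ::
  "('a::field ^ 2 \<Rightarrow> 'a ^ 2 \<Rightarrow> 'a ^ 2) \<Rightarrow> 'a ^ 2 \<Rightarrow> 'a ^ 2 \<Rightarrow> 'a ^ 2 \<Rightarrow> 'a ^ 2" where
  "generated3 \<mu> = (\<lambda>x y z. \<mu> x (\<mu> y z))"

definition A1 :: "'a::field \<Rightarrow> 'a \<Rightarrow> 'a \<Rightarrow> 'a \<Rightarrow> 'a ^ 4 ^ 2" where
  "A1 \<alpha>1 \<alpha>2 \<alpha>4 \<beta>1 = vector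
     [vector [\<alpha>1, \<alpha>2, \<alpha>2 + 1, \<alpha>4],
      vector [\<beta>1, - \<alpha>1, - \<alpha>1 + 1, - \<alpha>2]]"

definition A2 :: "'a::field \<Rightarrow> 'a \<Rightarrow> 'a \<Rightarrow> 'a ^ 4 ^ 2" where
  "A2 \<alpha>1 \<beta>1 \<beta>2 = vector
     [vector [\<alpha>1, 0, 0, 1],
      vector [\<beta>1, \<beta>2, 1 - \<alpha>1, 0]]"

definition A3 :: "'a::field \<Rightarrow> 'a \<Rightarrow> 'a ^ 4 ^ 2" where
  "A3 \<beta>1 \<beta>2 = vector
     [vector [0, 1, 1, 0],
      vector [\<beta>1, \<beta>2, 1, - 1]]"

definition A4 :: "'a::field \<Rightarrow> 'a \<Rightarrow> 'a ^ 4 ^ 2" where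
  "A4 \<alpha>1 \<beta>2 = vector
     [vector [\<alpha>1, 0, 0, 0],
      vector [0, \<beta>2, 1 - \<alpha>1, 0]]"

definition A5 :: "'a::field \<Rightarrow> 'a ^ 4 ^ 2" where
  "A5 \<alpha>1 = vector
     [vector [\<alpha>1, 0, 0, 0],
      vector [1, 2 * \<alpha>1 - 1, 1 - \<alpha>1, 0]]"

definition A6 :: "'a::field \<Rightarrow> 'a \<Rightarrow> 'a ^ 4 ^ 2" where
  "A6 \<alpha>1 \<beta>1 = vector
     [vector [\<alpha>1, 0, 0, 1],
      vector [\<beta>1, 1 - \<alpha>1, - \<alpha>1, 0]]"

definition A7 :: "'a::field \<Rightarrow> 'a ^ 4 ^ 2" where
  "A7 \<beta>1 = vector
     [vector [0, 1, 1, 0],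
      vector [\<beta>1, 1, 0, - 1]]"

definition A8 :: "'a::field \<Rightarrow> 'a ^ 4 ^ 2" where
  "A8 \<alpha>1 = vector
     [vector [\<alpha>1, 0, 0, 0],
      vector [0, 1 - \<alpha>1, - \<alpha>1, 0]]"

definition A9 :: "'a::field ^ 4 ^ 2" where
  "A9 = vector
     [vector [1 / 3, 0, 0, 0],
      vector [1, 2 / 3, - (1 / 3), 0]]"

definition A10 :: "'a::field ^ 4 ^ 2" where
  "A10 = vector
     [vector [0, 1, 1, 0],
      vector [0, 0, 0, - 1]]"

definition A11 :: "'a::field ^ 4 ^ 2" where
  "A11 = vector
     [vector [0, 1, 1, 0],
      vector [1, 0, 0, - 1]]"

end

theory Submission
  imports Defs
begin

text \<open>
  Write \<open>L x\<close> for the map \<open>\<mu> x\<close>.  If \<open>f x y z = \<mu> x (\<mu> y z)\<close>, then \<open>f x y\<close> is the operator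
  \<open>L x \<circ> L y\<close>.  Identify \<open>V\<close> with the commutative algebra of all \<open>p + q * i\<close>, where
  \<open>i * i = -1\<close>, by sending \<open>e1\<close> to \<open>1\<close> and \<open>e2\<close> to \<open>i\<close>, and let \<open>conj\<close> be its automorphism with
  \<open>conj i = -i\<close>.  Then the given 3-algebra is \<open>f x y z = x * y * conj z\<close>, which is symmetric in
  \<open>x\<close> and \<open>y\<close>.  Hence \<open>L e1\<close> and \<open>L e2\<close> commute, and so do the operators \<open>f e1 e1\<close> and
  \<open>f e1 e2\<close> (lemma \<open>generated3_operators_commute\<close>).  But \<open>f e1 e1\<close>, which is conjugation, and
  \<open>f e1 e2\<close>, which is conjugation followed by multiplication by \<open>i\<close>, anticommute: their two
  products send \<open>e1\<close> to \<open>-e2\<close> and to \<open>e2\<close>.  As \<open>2 \<noteq> 0\<close>, this is a contradiction.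

  Being generated by a binary operation is invariant under isomorphism
  (lemma \<open>generated3_transport\<close>), so all the non-isomorphism claims follow from the first claim.
\<close>

text \<open>
  Both sides are words in the operators \<open>\<mu> a\<close> and \<open>\<mu> b\<close> applied to \<open>z\<close>, and the assumption says
  that these two operators commute.
\<close>

lemma generated3_operators_commute:
  assumes "\<And>w. generated3 \<mu> a b w = generated3 \<mu> b a w"
  shows "generated3 \<mu> a a (generated3 \<mu> a b z) = generated3 \<mu> a b (generated3 \<mu> a a z)"
proof -
  have comm: "\<mu> b (\<mu> a w) = \<mu> a (\<mu> b w)" for w
    using assms[of w] by (simp add: generated3_def)
  show ?thesis
    by (simp add: generated3_def comm)
qed

text \<open>The operation \<open>\<nu>\<close> is \<open>\<mu>\<close> pulled back along the isomorphism.\<close>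

lemma generated3_transport:
  assumes "isomorphic3 f (generated3 \<mu>)"
  obtains \<nu> where "f = generated3 \<nu>"
proof -
  obtain \<phi> where \<phi>: "bij \<phi>" "\<And>x y z. \<phi> (f x y z) = \<mu> (\<phi> x) (\<mu> (\<phi> y) (\<phi> z))"
    using assms by (auto simp: isomorphic3_def generated3_def)
  have inv_left: "inv \<phi> (\<phi> u) = u" and inv_right: "\<phi> (inv \<phi> u) = u" for u
    using \<phi>(1) by (simp_all add: bij_is_inj bij_is_surj surj_f_inv_f)
  define \<nu> where "\<nu> = (\<lambda>x y. inv \<phi> (\<mu> (\<phi> x) (\<phi> y)))"
  have "f x y z = generated3 \<nu> x y z" for x y z
  proof -
    have "generated3 \<nu> x y z = inv \<phi> (\<phi> (f x y z))"
      by (simp add: generated3_def \<nu>_def inv_right \<phi>(2))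
    then show ?thesis
      by (simp add: inv_left)
  qed
  then have "f = generated3 \<nu>"
    by (intro ext)
  then show thesis
    by (rule that)
qed

lemma vector_8_nth:
  fixes a b c d e f g h :: "'a::zero"
  defines "v \<equiv> vector [a, b, c, d, e, f, g, h] :: 'a ^ 8"
  shows "v $ 1 = a" "v $ 2 = b" "v $ 3 = c" "v $ 4 = d" "v $ 5 = e" "v $ 6 = f"
  unfolding v_def by (simp_all add: vector_def)

lemma struct_matrix3_nth:
  "struct_matrix3 f $ i $ 1 = f e1 e1 e1 $ i"
  "struct_matrix3 f $ i $ 2 = f e1 e1 e2 $ i"
  "struct_matrix3 f $ i $ 3 = f e1 e2 e1 $ i"
  "struct_matrix3 f $ i $ 4 = f e1 e2 e2 $ i"
  "struct_matrix3 f $ i $ 5 = f e2 e1 e1 $ i"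
  "struct_matrix3 f $ i $ 6 = f e2 e1 e2 $ i"
  by (simp_all add: struct_matrix3_def transpose_def vector_8_nth)

lemma linear_eq_on_basis:
  fixes g h :: "'a::field ^ 2 \<Rightarrow> 'a ^ 2"
  assumes "Vector_Spaces.linear (*s) (*s) g" "Vector_Spaces.linear (*s) (*s) h"
    and "g e1 = h e1" "g e2 = h e2"
  shows "g w = h w"
proof -
  have w: "w = w $ 1 *s e1 + w $ 2 *s e2"
    by (simp add: vec_eq_iff forall_2 e1_def e2_def axis_def)
  show ?thesis
    by (subst (1 2) w)
       (simp only: vec.linear_add[OF assms(1)] vec.linear_scale[OF assms(1)]
          vec.linear_add[OF assms(2)] vec.linear_scale[OF assms(2)] assms(3,4))
qed

lemma two_neq_zero:
  assumes "CHAR('a::field) \<noteq> 2"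
  shows "(2::'a) \<noteq> 0"
proof
  assume "(2::'a) = 0"
  then have "CHAR('a) dvd 2"
    using of_nat_eq_0_iff_char_dvd[of 2, where ?'a = 'a] by simp
  with assms show False
    using two_is_prime_nat CHAR_not_1[where ?'a = 'a] by (auto simp: prime_nat_iff)
qed

lemma not_generated3:
  fixes f :: "'a::field ^ 2 \<Rightarrow> 'a ^ 2 \<Rightarrow> 'a ^ 2 \<Rightarrow> 'a ^ 2"
  assumes char: "CHAR('a) \<noteq> 2"
    and lin: "trilinear_map f"
    and mat: "struct_matrix3 f = vector
           [vector [1, 0, 0, 1, 0, 1, - 1, 0],
            vector [0, - 1, 1, 0, 1, 0, 0, 1]]"
  shows "f \<noteq> generated3 \<mu>"
proof
  assume gen: "f = generated3 \<mu>"
  have val: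
    "f e1 e1 e1 = e1" "f e1 e1 e2 = - e2" "f e1 e2 e1 = e2" "f e1 e2 e2 = e1"
    "f e2 e1 e1 = e2" "f e2 e1 e2 = e1"
    unfolding vec_eq_iff forall_2 struct_matrix3_nth[of f, symmetric] mat vector_2 vector_8_nth
    by (simp_all add: e1_def e2_def axis_def)
  have "f e1 e2 w = f e2 e1 w" for w
    using lin linear_eq_on_basis[of "f e1 e2" "f e2 e1" w] by (simp add: trilinear_map_def val)
  then have "f e1 e1 (f e1 e2 e1) = f e1 e2 (f e1 e1 e1)"
    unfolding gen by (rule generated3_operators_commute)
  then have "- e2 = (e2 :: 'a ^ 2)"
    by (simp add: val)
  then have "- 1 = (1 :: 'a)"
    by (simp add: vec_eq_iff forall_2 e2_def axis_def)
  then have "(2 :: 'a) = 0"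
    using add.right_inverse[of "1 :: 'a"] by simp
  with two_neq_zero[OF char] show False
    by contradiction
qed

theorem mainTheorem1:
  fixes f :: "'a::alg_closed_field ^ 2 \<Rightarrow> 'a ^ 2 \<Rightarrow> 'a ^ 2 \<Rightarrow> 'a ^ 2"
  assumes "CHAR('a) \<noteq> 2" and "CHAR('a) \<noteq> 3"
    and "trilinear_map f"
    and "struct_matrix3 f = vector
           [vector [1, 0, 0, 1, 0, 1, - 1, 0],
            vector [0, - 1, 1, 0, 1, 0, 0, 1]]"
  shows "(\<nexists>\<mu>. bilinear_map \<mu> \<and> (\<forall>x y z. f x y z = \<mu> x (\<mu> y z))) \<and>
    (\<forall>\<mu> \<alpha>1 \<alpha>2 \<alpha>4 \<beta>1. bilinear_map \<mu> \<and> struct_matrix2 \<mu> = A1 \<alpha>1 \<alpha>2 \<alpha>4 \<beta>1 \<longrightarrow>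
       \<not> isomorphic3 f (generated3 \<mu>)) \<and>
    (\<forall>\<mu> \<alpha>1 \<beta>1 \<beta>2. bilinear_map \<mu> \<and> struct_matrix2 \<mu> = A2 \<alpha>1 \<beta>1 \<beta>2 \<longrightarrow>
       \<not> isomorphic3 f (generated3 \<mu>)) \<and>
    (\<forall>\<mu> \<beta>1 \<beta>2. bilinear_map \<mu> \<and> struct_matrix2 \<mu> = A3 \<beta>1 \<beta>2 \<longrightarrow>
       \<not> isomorphic3 f (generated3 \<mu>)) \<and>
    (\<forall>\<mu> \<alpha>1 \<beta>2. bilinear_map \<mu> \<and> struct_matrix2 \<mu> = A4 \<alpha>1 \<beta>2 \<longrightarrow>
       \<not> isomorphic3 f (generated3 \<mu>)) \<and>
    (\<forall>\<mu> \<alpha>1. bilinear_map \<mu> \<and> struct_matrix2 \<mu> = A5 \<alpha>1 \<longrightarrow>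
       \<not> isomorphic3 f (generated3 \<mu>)) \<and>
    (\<forall>\<mu> \<alpha>1 \<beta>1. bilinear_map \<mu> \<and> struct_matrix2 \<mu> = A6 \<alpha>1 \<beta>1 \<longrightarrow>
       \<not> isomorphic3 f (generated3 \<mu>)) \<and>
    (\<forall>\<mu> \<beta>1. bilinear_map \<mu> \<and> struct_matrix2 \<mu> = A7 \<beta>1 \<longrightarrow>
       \<not> isomorphic3 f (generated3 \<mu>)) \<and>
    (\<forall>\<mu> \<alpha>1. bilinear_map \<mu> \<and> struct_matrix2 \<mu> = A8 \<alpha>1 \<longrightarrow>
       \<not> isomorphic3 f (generated3 \<mu>)) \<and>
    (\<forall>\<mu>. bilinear_map \<mu> \<and> struct_matrix2 \<mu> = A9 \<longrightarrow>
       \<not> isomorphic3 f (generated3 \<mu>)) \<and>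
    (\<forall>\<mu>. bilinear_map \<mu> \<and> struct_matrix2 \<mu> = A10 \<longrightarrow>
       \<not> isomorphic3 f (generated3 \<mu>)) \<and>
    (\<forall>\<mu>. bilinear_map \<mu> \<and> struct_matrix2 \<mu> = A11 \<longrightarrow>
       \<not> isomorphic3 f (generated3 \<mu>))"
proof -
  note not_gen = not_generated3[OF assms(1,3,4)]
  have "\<not> isomorphic3 f (generated3 \<mu>)" for \<mu>
    using not_gen by (blast elim: generated3_transport)
  moreover have "\<not> (\<forall>x y z. f x y z = \<mu> x (\<mu> y z))" for \<mu>
    using not_gen[of \<mu>] by (simp add: generated3_def fun_eq_iff)
  ultimately show ?thesis
    by blast
qed

end
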